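(* Let $\mathcal I$ be a small step alternating pushdown system and let $\mathcal I_{\neg}$ and $\mathcal I'_{\neg}$ be as defined below. For every configuration $A$, the proposition $\neg A$ has a (finite) proof in $\mathcal I'_{\neg}$ if and only if it has a co-inductive proof in $\mathcal I_{\neg}$.
   Context: Fix a language with finitely many unary predicate symbols (states), finitely many unary function symbols (stack symbols), a constant $\varepsilon$ and a variable $x$. Words are closed terms $\gamma_1(\cdots\gamma_n(\varepsilon))$; configurations are atomic propositions $P(w)$ with $P$ a state and $w$ a word. Besides atomic propositions we use formal negations $\neg A$. For an inference system $\mathcal J$ (a set of rules with finitely many premises, each premise and the conclusion being an atomic proposition or its negation, possibly containing $x$), a proof of a closed proposition $C$ is a finite tree with root $C$ in which each node is labeled $\sigma B$ and its children $\sigma A_1,\dots,\sigma A_n$ for some rule $\frac{A_1\cdots A_n}{B}\in\mathcal J$ and substitution $\sigma$ of a word for $x$; a co-inductive proof is the same with possibly infinite trees. Rule types: an introduction rule is $\frac{P_1(x)\cdots P_n(x)}{Q(\gamma x)}$ ($\gamma$ a stack symbol, $n\ge0$) or $\frac{}{Q(\varepsilon)}$; an elimination rule is $\frac{P_1(\gamma x)\ P_2(x)\cdots P_n(x)}{Q(x)}$ ($n\ge1$); a neutral rule is $\frac{P_1(x)\cdots P_n(x)}{Q(x)}$ ($n\ge0$). A small step alternating pushdown system is a finite set of introduction, elimination and neutral rules; premises of rules are regarded as sets. Saturation: $\mathcal I_s$ is the smallest set of rules containing $\mathcal I$ and closed under (1) from an introduction rule $\frac{P_1(x)\cdots P_m(x)}{Q_1(\gamma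 x)}$ and an elimination rule $\frac{Q_1(\gamma x)\ Q_2(x)\cdots Q_n(x)}{R(x)}$, add $\frac{P_1(x)\cdots P_m(x)\ Q_2(x)\cdots Q_n(x)}{R(x)}$; (2) from introduction rules $\frac{P^i_1(x)\cdots P^i_{m_i}(x)}{Q_i(\gamma x)}$ ($i=1..n$, same $\gamma$) and a neutral rule $\frac{Q_1(x)\cdots Q_n(x)}{R(x)}$ ($n\ge0$), add $\frac{P^1_1(x)\cdots P^n_{m_n}(x)}{R(\gamma x)}$ (all premises together; for $n=0$, $\frac{}{R(\gamma x)}$ for every $\gamma$); (3) from introduction rules $\frac{}{Q_i(\varepsilon)}$ ($i=1..n$) and a neutral rule $\frac{Q_1(x)\cdots Q_n(x)}{R(x)}$ ($n\ge0$), add $\frac{}{R(\varepsilon)}$. $\mathcal I'$ is the alternating multi-automaton obtained from $\mathcal I_s$ by removing all elimination and neutral rules. For a small step system $\mathcal J$: $\tilde{\mathcal J}$ keeps the introduction rules of $\mathcal J$ and replaces each neutral or elimination rule (conclusion $P(x)$) by its instance with $x:=\varepsilon$ and its instances with $x:=\gamma x$ for every stack symbol $\gamma$; $\mathcal C$ is the set of all $P(\varepsilon)$, $P(\gamma x)$. Then $\mathcal J_{\neg}$ consists of the rules of $\mathcal J$ together with, for each $B\in\mathcal C$, letting $r_1,\dots,r_n$ ($n\ge0$) be the rules of $\tilde{\mathcal J}$ with conclusion $B$ and $A^i_1,\dots,A^i_{m_i}$ the premises of $r_i$, all rules $\frac{\neg A^1_{j_1}\ \cdots\ \neg A^n_{j_n}}{\neg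 B}$ for $1\le j_i\le m_i$ (the single rule $\frac{}{\neg B}$ if $n=0$). $\mathcal I_{\neg}$ and $\mathcal I'_{\neg}$ are this construction applied to $\mathcal J=\mathcal I$ and $\mathcal J=\mathcal I'$ respectively. *)

theory Defs imports Main begin

datatype 'g trm = Eps | Var | App 'g "'g trm"

datatype ('p, 'g) atom = Atom 'p "'g trm"

datatype ('p, 'g) literal = Pos "('p, 'g) atom" | Neg "('p, 'g) atom"

primrec subst_trm :: "'g trm \<Rightarrow> 'g trm \<Rightarrow> 'g trm" where
  "subst_trm s Eps = Eps"
| "subst_trm s Var = s"
| "subst_trm s (App g t) = App g (subst_trm s t)"

primrec subst_atom :: "'g trm \<Rightarrow> ('p, 'g) atom \<Rightarrow> ('p, 'g) atom" where
  "subst_atom s (Atom p t) = Atom p (subst_trm s t)"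

primrec subst_literal :: "'g trm \<Rightarrow> ('p, 'g) literal \<Rightarrow> ('p, 'g) literal" where
  "subst_literal s (Pos A) = Pos (subst_atom s A)"
| "subst_literal s (Neg A) = Neg (subst_atom s A)"

text \<open>The states and the stack symbols are explicit carriers \<open>St\<close> and \<open>Gam\<close> rather
  than finite types, so that an empty set of stack symbols is not excluded.\<close>

inductive_set words :: "'g set \<Rightarrow> 'g trm set" for Gam where
  Eps: "Eps \<in> words Gam"
| App: "g \<in> Gam \<Longrightarrow> w \<in> words Gam \<Longrightarrow> App g w \<in> words Gam"

definition configurations :: "'p set \<Rightarrow> 'g set \<Rightarrow> ('p, 'g) atom set" where
  "configurations St Gam = {Atom p w |p w. p \<in> St \<and> w \<in> words Gam}"

datatype 'f rule = Rule (prems: "'f set") (concl: 'f)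


subsection \<open>Proofs and co-inductive proofs\<close>

text \<open>A \<open>tree\<close> is finitely branching, but may have infinite branches.\<close>

codatatype 'f tree = Node (label: 'f) (children: "'f tree list")

text \<open>By finite branching, the well-founded trees are exactly the finite ones.\<close>

inductive finite_tree :: "'f tree \<Rightarrow> bool" where
  "(\<And>t. t \<in> set ts \<Longrightarrow> finite_tree t) \<Longrightarrow> finite_tree (Node C ts)"

text \<open>The list \<open>As\<close> enumerates the premises without repetition, so a node has one child
  for each premise.\<close>

definition rule_instance ::
    "'g set \<Rightarrow> ('p, 'g) literal rule set \<Rightarrow> ('p, 'g) literal list \<Rightarrow> ('p, 'g) literal \<Rightarrow> bool" where
  "rule_instance Gam J Cs C \<longleftrightarrow>
     (\<exists>As B. \<exists>w \<in> words Gam. Rule (set As) B \<in> J \<and> distinct As \<and>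
        Cs = map (subst_literal w) As \<and> C = subst_literal w B)"

coinductive correct_tree ::
    "'g set \<Rightarrow> ('p, 'g) literal rule set \<Rightarrow> ('p, 'g) literal tree \<Rightarrow> bool" for Gam J where
  "rule_instance Gam J (map label ts) C \<Longrightarrow> (\<And>t. t \<in> set ts \<Longrightarrow> correct_tree Gam J t) \<Longrightarrow>
     correct_tree Gam J (Node C ts)"

definition has_proof ::
    "'g set \<Rightarrow> ('p, 'g) literal rule set \<Rightarrow> ('p, 'g) literal \<Rightarrow> bool" where
  "has_proof Gam J C \<longleftrightarrow> (\<exists>t. finite_tree t \<and> correct_tree Gam J t \<and> label t = C)"

definition has_coinductive_proof ::
    "'g set \<Rightarrow> ('p, 'g) literal rule set \<Rightarrow> ('p, 'g) literal \<Rightarrow> bool" where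
  "has_coinductive_proof Gam J C \<longleftrightarrow> (\<exists>t. correct_tree Gam J t \<and> label t = C)"


subsection \<open>Small step alternating pushdown systems\<close>

definition at_x :: "'p set \<Rightarrow> ('p, 'g) atom set" where
  "at_x S = (\<lambda>p. Atom p Var) ` S"

definition intro_rules :: "'p set \<Rightarrow> 'g set \<Rightarrow> ('p, 'g) atom rule set" where
  "intro_rules St Gam =
     {Rule (at_x S) (Atom q (App g Var)) |S q g. S \<subseteq> St \<and> q \<in> St \<and> g \<in> Gam} \<union>
     {Rule {} (Atom q Eps) |q. q \<in> St}"

definition elim_rules :: "'p set \<Rightarrow> 'g set \<Rightarrow> ('p, 'g) atom rule set" where
  "elim_rules St Gam =
     {Rule (insert (Atom p (App g Var)) (at_x S)) (Atom q Var) |p g S q.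
        p \<in> St \<and> g \<in> Gam \<and> S \<subseteq> St \<and> q \<in> St}"

definition neutral_rules :: "'p set \<Rightarrow> ('p, 'g) atom rule set" where
  "neutral_rules St = {Rule (at_x S) (Atom q Var) |S q. S \<subseteq> St \<and> q \<in> St}"

definition small_step_apds :: "'p set \<Rightarrow> 'g set \<Rightarrow> ('p, 'g) atom rule set \<Rightarrow> bool" where
  "small_step_apds St Gam I \<longleftrightarrow>
     finite I \<and> I \<subseteq> intro_rules St Gam \<union> elim_rules St Gam \<union> neutral_rules St"


subsection \<open>Saturation\<close>

text \<open>In \<open>intro_neutral\<close>, \<open>S q\<close> is the premise set of the introduction rule chosen for the
  premise \<open>q\<close> of the neutral rule; the condition \<open>g \<in> Gam\<close> is needed for \<open>T = {}\<close>.\<close>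

inductive_set saturation :: "'g set \<Rightarrow> ('p, 'g) atom rule set \<Rightarrow> ('p, 'g) atom rule set"
  for Gam I where
  base: "r \<in> I \<Longrightarrow> r \<in> saturation Gam I"
| intro_elim:
    "Rule (at_x S) (Atom q (App g Var)) \<in> saturation Gam I \<Longrightarrow>
     Rule (insert (Atom q (App g Var)) (at_x T)) (Atom r Var) \<in> saturation Gam I \<Longrightarrow>
     Rule (at_x (S \<union> T)) (Atom r Var) \<in> saturation Gam I"
| intro_neutral:
    "g \<in> Gam \<Longrightarrow>
     (\<And>q. q \<in> T \<Longrightarrow> Rule (at_x (S q)) (Atom q (App g Var)) \<in> saturation Gam I) \<Longrightarrow>
     Rule (at_x T) (Atom r Var) \<in> saturation Gam I \<Longrightarrow>
     Rule (at_x (\<Union>q\<in>T. S q)) (Atom r (App g Var)) \<in> saturation Gam I"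
| empty_neutral:
    "(\<And>q. q \<in> T \<Longrightarrow> Rule {} (Atom q Eps) \<in> saturation Gam I) \<Longrightarrow>
     Rule (at_x T) (Atom r Var) \<in> saturation Gam I \<Longrightarrow>
     Rule {} (Atom r Eps) \<in> saturation Gam I"

definition automaton ::
    "'p set \<Rightarrow> 'g set \<Rightarrow> ('p, 'g) atom rule set \<Rightarrow> ('p, 'g) atom rule set" where
  "automaton St Gam I = saturation Gam I - (elim_rules St Gam \<union> neutral_rules St)"


subsection \<open>Complementation\<close>

definition head_terms :: "'g set \<Rightarrow> 'g trm set" where
  "head_terms Gam = insert Eps ((\<lambda>g. App g Var) ` Gam)"

definition subst_rule :: "'g trm \<Rightarrow> ('p, 'g) atom rule \<Rightarrow> ('p, 'g) atom rule" where
  "subst_rule s r = Rule (subst_atom s ` prems r) (subst_atom s (concl r))"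

definition tilde ::
    "'p set \<Rightarrow> 'g set \<Rightarrow> ('p, 'g) atom rule set \<Rightarrow> ('p, 'g) atom rule set" where
  "tilde St Gam J =
     (J \<inter> intro_rules St Gam) \<union>
     {subst_rule s r |s r. s \<in> head_terms Gam \<and>
        r \<in> J \<inter> (elim_rules St Gam \<union> neutral_rules St)}"

definition heads :: "'p set \<Rightarrow> 'g set \<Rightarrow> ('p, 'g) atom set" where
  "heads St Gam = {Atom p s |p s. p \<in> St \<and> s \<in> head_terms Gam}"

definition rules_for :: "('p, 'g) atom rule set \<Rightarrow> ('p, 'g) atom \<Rightarrow> ('p, 'g) atom rule set" where
  "rules_for J B = {r \<in> J. concl r = B}"

text \<open>The function \<open>f\<close> below selects one premise of each rule concluding \<open>B\<close>; there is none
  if some such rule has no premises.\<close>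

definition negation_rules ::
    "'p set \<Rightarrow> 'g set \<Rightarrow> ('p, 'g) atom rule set \<Rightarrow> ('p, 'g) literal rule set" where
  "negation_rules St Gam J =
     {Rule ((\<lambda>r. Neg (f r)) ` rules_for (tilde St Gam J) B) (Neg B) |B f.
        B \<in> heads St Gam \<and> (\<forall>r \<in> rules_for (tilde St Gam J) B. f r \<in> prems r)}"

definition with_negation ::
    "'p set \<Rightarrow> 'g set \<Rightarrow> ('p, 'g) atom rule set \<Rightarrow> ('p, 'g) literal rule set" where
  "with_negation St Gam J =
     (\<lambda>r. Rule (Pos ` prems r) (Pos (concl r))) ` J \<union> negation_rules St Gam J"

end

theory Submission imports Defs begin

text \<open>In both systems \<open>Neg A\<close> has a co-inductive proof iff \<open>A\<close> has no proof: a co-inductive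
  refutation selects, for every rule that could conclude \<open>A\<close>, an unprovable premise. Saturation
  makes the elimination and neutral rules admissible, so the system and its automaton
  prove the same configurations. Finally, all rules of the automaton strip a symbol from the
  word when read upwards, so that its co-inductive refutations are finite.\<close>

subsection \<open>Proof trees\<close>

lemma has_proofI:
  assumes "rule_instance Gam J Cs C" and "\<And>D. D \<in> set Cs \<Longrightarrow> has_proof Gam J D"
  shows "has_proof Gam J C"
proof -
  obtain t where t: "\<And>D. D \<in> set Cs \<Longrightarrow> finite_tree (t D) \<and> correct_tree Gam J (t D) \<and> label (t D) = D"
    using assms(2) unfolding has_proof_def by metis
  have "map label (map t Cs) = Cs"
    using t by (simp add: map_idI)
  then have "correct_tree Gam J (Node C (map t Cs))"
    using assms(1) t by (intro correct_tree.intros) auto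
  moreover have "finite_tree (Node C (map t Cs))"
    using t by (intro finite_tree.intros) auto
  ultimately show ?thesis
    unfolding has_proof_def by (metis tree.sel(1))
qed

lemma has_coinductive_proof_if_has_proof: "has_proof Gam J C \<Longrightarrow> has_coinductive_proof Gam J C"
  unfolding has_proof_def has_coinductive_proof_def by blast

lemma has_coinductive_proofD:
  assumes "has_coinductive_proof Gam J C"
  shows "\<exists>Cs. rule_instance Gam J Cs C \<and> (\<forall>D \<in> set Cs. has_coinductive_proof Gam J D)"
proof -
  obtain t where "correct_tree Gam J t" "label t = C"
    using assms unfolding has_coinductive_proof_def by blast
  then obtain ts where "rule_instance Gam J (map label ts) C" "\<And>t. t \<in> set ts \<Longrightarrow> correct_tree Gam J t"
    by (auto elim: correct_tree.cases)
  then show ?thesis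
    unfolding has_coinductive_proof_def by (intro exI[of _ "map label ts"]) auto
qed

text \<open>Here \<open>k\<close> is a strategy assigning to each formula the premises from which it
  is to be derived; the tree arises by following it forever.\<close>

primcorec unfold_tree :: "('f \<Rightarrow> 'f list) \<Rightarrow> 'f \<Rightarrow> 'f tree" where
  "unfold_tree k C = Node C (map (unfold_tree k) (k C))"

text \<open>An invariant closed under going backwards through some rule instance is enough: one
  instance is fixed for each formula satisfying \<open>X\<close>, and unfolding this choice gives a
  possibly infinite correct tree.\<close>

lemma has_coinductive_proof_coinduct:
  assumes "X C" and step: "\<And>C. X C \<Longrightarrow> \<exists>Cs. rule_instance Gam J Cs C \<and> (\<forall>D \<in> set Cs. X D)"
  shows "has_coinductive_proof Gam J C"
proof -
  obtain k where k: "\<And>C. X C \<Longrightarrow> rule_instance Gam J (k C) C \<and> (\<forall>D \<in> set (k C). X D)"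
    using step by metis
  have "correct_tree Gam J t" if "\<exists>C. X C \<and> t = unfold_tree k C" for t
    using that
  proof (coinduction arbitrary: t)
    case correct_tree
    then obtain C where C: "X C" "t = unfold_tree k C" by blast
    have "t = Node C (map (unfold_tree k) (k C))"
      using C(2) unfold_tree.code by metis
    moreover have "map label (map (unfold_tree k) (k C)) = k C"
      by (simp add: map_idI)
    ultimately show ?case
      using k[OF C(1)]
      by (intro exI[of _ "map (unfold_tree k) (k C)"] exI[of _ C]) auto
  qed
  then show ?thesis
    unfolding has_coinductive_proof_def using assms(1) by (metis unfold_tree.simps(1))
qed

subsection \<open>Provable configurations\<close>

text \<open>The least fixed point counterpart of finite proofs, restricted to positive atoms. It
  replaces trees by rule induction, and it takes premises as a set, without enumerating
  them.\<close>

inductive provable :: "'g set \<Rightarrow> ('p, 'g) atom rule set \<Rightarrow> ('p, 'g) atom \<Rightarrow> bool" for Gam J where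
  provableI: "r \<in> J \<Longrightarrow> w \<in> words Gam \<Longrightarrow> (\<And>a. a \<in> prems r \<Longrightarrow> provable Gam J (subst_atom w a)) \<Longrightarrow>
    provable Gam J (subst_atom w (concl r))"

abbreviation small_step_rules :: "'p set \<Rightarrow> 'g set \<Rightarrow> ('p, 'g) atom rule set" where
  "small_step_rules St Gam \<equiv> intro_rules St Gam \<union> elim_rules St Gam \<union> neutral_rules St"

lemma subst_atom_subst_atom: "subst_atom w (subst_atom s a) = subst_atom (subst_trm w s) a"
proof (cases a)
  case (Atom p t)
  have "subst_trm w (subst_trm s t) = subst_trm (subst_trm w s) t"
    by (induction t) auto
  with Atom show ?thesis by simp
qed

lemma subst_head_in_words: "s \<in> head_terms Gam \<Longrightarrow> w \<in> words Gam \<Longrightarrow> subst_trm w s \<in> words Gam"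
  by (auto simp: head_terms_def intro: words.intros)

text \<open>A word is empty or begins with a stack symbol, so the heads cover all configurations; in
  the second case \<open>w\<close> is the tail of the word.\<close>

lemma configuration_head:
  assumes "A \<in> configurations St Gam"
  obtains B w where "B \<in> heads St Gam" "w \<in> words Gam" "A = subst_atom w B"
proof -
  obtain p v where A: "A = Atom p v" "p \<in> St" "v \<in> words Gam"
    using assms by (auto simp: configurations_def)
  from A(3) show thesis
  proof cases
    case Eps
    with A show ?thesis
      by (intro that[of "Atom p Eps" Eps]) (auto simp: heads_def head_terms_def intro: words.intros)
  next
    case (App g w)
    with A show ?thesis
      by (intro that[of "Atom p (App g Var)" w]) (auto simp: heads_def head_terms_def)
  qed
qed

lemma prems_configuration:
  assumes "r \<in> small_step_rules St Gam" "a \<in> prems r" "w \<in> words Gam"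
  shows "subst_atom w a \<in> configurations St Gam"
proof -
  have "(\<exists>p \<in> St. a = Atom p Var) \<or> (\<exists>p \<in> St. \<exists>g \<in> Gam. a = Atom p (App g Var))"
    using assms(1,2) by (fastforce simp: intro_rules_def elim_rules_def neutral_rules_def at_x_def)
  with assms(3) show ?thesis
    by (auto simp: configurations_def intro: words.App)
qed

text \<open>An introduction rule already shows the outermost symbol of its conclusion, while the
  conclusion of an elimination or neutral rule is a bare variable, which \<open>tilde\<close>
  instantiates with the head term of \<open>B\<close>. Hence \<open>tilde\<close> misses no way of
  concluding an instance of \<open>B\<close>.\<close>

lemma tilde_complete:
  assumes J: "J \<subseteq> small_step_rules St Gam" and r: "r \<in> J"
    and B: "B \<in> heads St Gam" and eq: "subst_atom v (concl r) = subst_atom w B"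
  shows "\<exists>r' \<in> rules_for (tilde St Gam J) B. subst_atom w ` prems r' = subst_atom v ` prems r"
proof -
  obtain p s where s: "B = Atom p s" "s \<in> head_terms Gam"
    using B by (auto simp: heads_def)
  consider "r \<in> intro_rules St Gam" | "r \<in> elim_rules St Gam \<union> neutral_rules St"
    using J r by blast
  then show ?thesis
  proof cases
    case 1
    \<comment> \<open>If the conclusion is at \<open>Eps\<close>, then \<open>v\<close> and
      \<open>w\<close> may differ, but there are no premises; if it is at \<open>App g Var\<close>,
      then \<open>v = w\<close>.\<close>
    have "concl r = B \<and> subst_atom w ` prems r = subst_atom v ` prems r"
      using 1 s eq by (auto simp: intro_rules_def head_terms_def at_x_def)
    with 1 r show ?thesis
      by (intro bexI[of _ r]) (auto simp: rules_for_def tilde_def)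
  next
    case 2
    then obtain q where q: "concl r = Atom q Var"
      by (auto simp: elim_rules_def neutral_rules_def)
    with eq s have v: "q = p" "v = subst_trm w s" by auto
    have "subst_rule s r \<in> rules_for (tilde St Gam J) B"
      using 2 r s q v by (auto simp: rules_for_def tilde_def subst_rule_def)
    moreover have "subst_atom w ` prems (subst_rule s r) = subst_atom v ` prems r"
      by (simp add: subst_rule_def image_image subst_atom_subst_atom v)
    ultimately show ?thesis by blast
  qed
qed

text \<open>Substituting \<open>w\<close> after a head term \<open>s\<close> is the same as
  substituting the single word \<open>subst_trm w s\<close>, so instances of \<open>tilde\<close>
  rules are instances of the original ones.\<close>

lemma tilde_sound:
  assumes r': "r' \<in> rules_for (tilde St Gam J) B" and w: "w \<in> words Gam"
  shows "\<exists>r \<in> J. \<exists>v \<in> words Gam. subst_atom v (concl r) = subst_atom w B \<and>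
    subst_atom v ` prems r = subst_atom w ` prems r'"
proof -
  have B: "concl r' = B" using r' by (simp add: rules_for_def)
  consider "r' \<in> J" | s r where "r' = subst_rule s r" "s \<in> head_terms Gam" "r \<in> J"
    using r' by (auto simp: rules_for_def tilde_def)
  then show ?thesis
  proof cases
    case 1
    with B w show ?thesis by blast
  next
    case 2
    then show ?thesis
      using B w subst_head_in_words[OF 2(2) w]
      by (intro bexI[of _ r] bexI[of _ "subst_trm w s"])
        (auto simp: subst_rule_def image_image subst_atom_subst_atom)
  qed
qed

subsection \<open>Complementation\<close>

text \<open>A negation rule selects a premise for each of these rules, and
  \<open>rule_instance\<close> needs the selected premises as a list.\<close>

lemma finite_rules_for_tilde:
  assumes "finite Gam" "finite J"
  shows "finite (rules_for (tilde St Gam J) B)"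
proof -
  have "finite (head_terms Gam)"
    using assms(1) by (simp add: head_terms_def)
  have "tilde St Gam J \<subseteq> J \<union> (\<lambda>(s, r). subst_rule s r) ` (head_terms Gam \<times> J)"
    by (auto simp: tilde_def)
  then have "finite (tilde St Gam J)"
    by (rule finite_subset) (use assms \<open>finite (head_terms Gam)\<close> in auto)
  then show ?thesis by (simp add: rules_for_def)
qed

lemma rule_instance_NegE:
  assumes "rule_instance Gam (with_negation St Gam J) Cs (Neg A)"
  obtains B f w where "B \<in> heads St Gam" "w \<in> words Gam" "A = subst_atom w B"
    "\<And>r. r \<in> rules_for (tilde St Gam J) B \<Longrightarrow> f r \<in> prems r"
    "set Cs = (\<lambda>r. Neg (subst_atom w (f r))) ` rules_for (tilde St Gam J) B"
proof -
  obtain As L w where L: "Rule (set As) L \<in> with_negation St Gam J" "w \<in> words Gam"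
    "Cs = map (subst_literal w) As" "Neg A = subst_literal w L"
    using assms by (auto simp: rule_instance_def)
  \<comment> \<open>A negative conclusion excludes the positive rules of the system.\<close>
  obtain B where "L = Neg B" "A = subst_atom w B"
    using L(4) by (cases L) auto
  with L(1) obtain f where f: "B \<in> heads St Gam"
    "set As = (\<lambda>r. Neg (f r)) ` rules_for (tilde St Gam J) B"
    "\<forall>r \<in> rules_for (tilde St Gam J) B. f r \<in> prems r"
    by (auto simp: with_negation_def negation_rules_def)
  show thesis
    using f L(2,3) \<open>A = subst_atom w B\<close>
    by (intro that[of B w f]) (auto simp: image_image)
qed

lemma rule_instance_NegI:
  assumes "finite (rules_for (tilde St Gam J) B)" "B \<in> heads St Gam" "w \<in> words Gam"
    and "\<And>r. r \<in> rules_for (tilde St Gam J) B \<Longrightarrow> f r \<in> prems r"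
  obtains Cs where "rule_instance Gam (with_negation St Gam J) Cs (Neg (subst_atom w B))"
    "set Cs = (\<lambda>r. Neg (subst_atom w (f r))) ` rules_for (tilde St Gam J) B"
proof -
  let ?P = "(\<lambda>r. Neg (f r)) ` rules_for (tilde St Gam J) B"
  \<comment> \<open>Two rules may select the same premise; \<open>As\<close> then lists it only
    once.\<close>
  obtain As where As: "set As = ?P" "distinct As"
    using assms(1) finite_distinct_list[of ?P] by auto
  have "Rule (set As) (Neg B) \<in> with_negation St Gam J"
    using assms(2,4) As(1) by (auto simp: with_negation_def negation_rules_def)
  then have "rule_instance Gam (with_negation St Gam J) (map (subst_literal w) As) (Neg (subst_atom w B))"
    unfolding rule_instance_def using assms(3) As(2) by (metis subst_literal.simps(2))
  then show thesis
    by (rule that) (simp add: As(1) image_image)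
qed

text \<open>Induction on the proof of \<open>A\<close>: a refutation selects a premise of every rule
  that could conclude \<open>A\<close>, in particular of the last rule of the proof, and that
  premise is both provable and refutable.\<close>

lemma provable_not_refutable:
  assumes "J \<subseteq> small_step_rules St Gam" and "provable Gam J A"
  shows "\<not> has_coinductive_proof Gam (with_negation St Gam J) (Neg A)"
  using assms(2)
proof induction
  case (provableI r v)
  show ?case
  proof
    assume "has_coinductive_proof Gam (with_negation St Gam J) (Neg (subst_atom v (concl r)))"
    then obtain Cs where Cs: "rule_instance Gam (with_negation St Gam J) Cs (Neg (subst_atom v (concl r)))"
      "\<forall>D \<in> set Cs. has_coinductive_proof Gam (with_negation St Gam J) D"
      using has_coinductive_proofD by blast
    obtain B f w where B: "B \<in> heads St Gam" "subst_atom v (concl r) = subst_atom w B"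
      and f: "\<And>r. r \<in> rules_for (tilde St Gam J) B \<Longrightarrow> f r \<in> prems r"
      and Cs_eq: "set Cs = (\<lambda>r. Neg (subst_atom w (f r))) ` rules_for (tilde St Gam J) B"
      using rule_instance_NegE[OF Cs(1)] by metis
    obtain r' where r': "r' \<in> rules_for (tilde St Gam J) B"
      "subst_atom w ` prems r' = subst_atom v ` prems r"
      using tilde_complete[OF assms(1) provableI(1) B] by blast
    then obtain a where "a \<in> prems r" "subst_atom w (f r') = subst_atom v a"
      using f[OF r'(1)] by (metis image_iff)
    then show False
      using provableI.IH Cs(2) Cs_eq r'(1) by (metis imageI)
  qed
qed

text \<open>Coinduction with the unprovable configurations as invariant. Staying among
  configurations matters because negation rules exist only for heads over \<open>St\<close> and
  \<open>Gam\<close>.\<close>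

lemma unprovable_refutable:
  assumes J: "J \<subseteq> small_step_rules St Gam" and fin: "finite Gam" "finite J"
    and A: "A \<in> configurations St Gam" "\<not> provable Gam J A"
  shows "has_coinductive_proof Gam (with_negation St Gam J) (Neg A)"
proof (rule has_coinductive_proof_coinduct
    [where X = "\<lambda>C. \<exists>A. C = Neg A \<and> A \<in> configurations St Gam \<and> \<not> provable Gam J A"])
  show "\<exists>A'. Neg A = Neg A' \<and> A' \<in> configurations St Gam \<and> \<not> provable Gam J A'"
    using A by blast
next
  fix C :: "('a, 'b) literal"
  assume "\<exists>A. C = Neg A \<and> A \<in> configurations St Gam \<and> \<not> provable Gam J A"
  then obtain B w where C: "C = Neg (subst_atom w B)" and B: "B \<in> heads St Gam" "w \<in> words Gam"
    and np: "\<not> provable Gam J (subst_atom w B)"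
    by (metis configuration_head)
  have "\<exists>a \<in> prems r. subst_atom w a \<in> configurations St Gam \<and> \<not> provable Gam J (subst_atom w a)"
    if r: "r \<in> rules_for (tilde St Gam J) B" for r
  proof -
    obtain r0 v where r0: "r0 \<in> J" "v \<in> words Gam" "subst_atom v (concl r0) = subst_atom w B"
      "subst_atom v ` prems r0 = subst_atom w ` prems r"
      using tilde_sound[OF r B(2)] by blast
    \<comment> \<open>If all premises of this instance were provable, its conclusion would be
      too.\<close>
    obtain a where a: "a \<in> prems r0" "\<not> provable Gam J (subst_atom v a)"
      using np r0 provableI by metis
    moreover have "subst_atom v a \<in> configurations St Gam"
      using prems_configuration a(1) r0(1,2) J by blast
    moreover obtain b where "b \<in> prems r" "subst_atom v a = subst_atom w b"
      using a(1) r0(4) by blast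
    ultimately show ?thesis by metis
  qed
  then obtain f where f: "\<And>r. r \<in> rules_for (tilde St Gam J) B \<Longrightarrow> f r \<in> prems r \<and>
      subst_atom w (f r) \<in> configurations St Gam \<and> \<not> provable Gam J (subst_atom w (f r))"
    by metis
  obtain Cs where Cs: "rule_instance Gam (with_negation St Gam J) Cs C"
    "set Cs = (\<lambda>r. Neg (subst_atom w (f r))) ` rules_for (tilde St Gam J) B"
    using rule_instance_NegI[OF finite_rules_for_tilde[OF fin] B] f C by metis
  have "\<forall>D \<in> set Cs. \<exists>A. D = Neg A \<and> A \<in> configurations St Gam \<and> \<not> provable Gam J A"
    unfolding Cs(2) using f by blast
  with Cs(1) show "\<exists>Cs. rule_instance Gam (with_negation St Gam J) Cs C \<and>
      (\<forall>D \<in> set Cs. \<exists>A. D = Neg A \<and> A \<in> configurations St Gam \<and> \<not> provable Gam J A)"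
    by blast
qed

lemma refutable_iff_unprovable:
  assumes "J \<subseteq> small_step_rules St Gam" "finite Gam" "finite J" "A \<in> configurations St Gam"
  shows "has_coinductive_proof Gam (with_negation St Gam J) (Neg A) \<longleftrightarrow> \<not> provable Gam J A"
  using provable_not_refutable unprovable_refutable assms by metis

text \<open>Premises of introduction rules speak about the tail of the word in the conclusion, so
  the length of the word bounds the depth of a refutation.\<close>

lemma intro_rules_refutation_finite:
  assumes J: "J \<subseteq> intro_rules St Gam"
    and "has_coinductive_proof Gam (with_negation St Gam J) (Neg (Atom p w))"
  shows "has_proof Gam (with_negation St Gam J) (Neg (Atom p w))"
  using assms(2)
proof (induction w arbitrary: p rule: measure_induct_rule[of size])
  case (less w)
  obtain Cs where Cs: "rule_instance Gam (with_negation St Gam J) Cs (Neg (Atom p w))"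
    "\<forall>D \<in> set Cs. has_coinductive_proof Gam (with_negation St Gam J) D"
    using has_coinductive_proofD[OF less.prems] by blast
  obtain B f v where B: "Atom p w = subst_atom v B"
    and f: "\<And>r. r \<in> rules_for (tilde St Gam J) B \<Longrightarrow> f r \<in> prems r"
    and Cs_eq: "set Cs = (\<lambda>r. Neg (subst_atom v (f r))) ` rules_for (tilde St Gam J) B"
    using rule_instance_NegE[OF Cs(1)] by metis
  show ?case
  proof (rule has_proofI[OF Cs(1)])
    fix D assume D: "D \<in> set Cs"
    then obtain r where r: "r \<in> rules_for (tilde St Gam J) B" "D = Neg (subst_atom v (f r))"
      using Cs_eq by blast
    \<comment> \<open>Introduction rules never conclude at a variable, so \<open>tilde\<close> adds
      no instances to \<open>J\<close>.\<close>
    have "J \<inter> (elim_rules St Gam \<union> neutral_rules St) = {}"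
      using J by (fastforce simp: intro_rules_def elim_rules_def neutral_rules_def)
    then have "r \<in> intro_rules St Gam" "concl r = B"
      using r(1) by (auto simp: rules_for_def tilde_def)
    \<comment> \<open>A rule concluding at \<open>Eps\<close> has no premise for \<open>f\<close> to
      select, so the head must be an \<open>App\<close>.\<close>
    then obtain g q where "w = App g v" "f r = Atom q Var"
      using f[OF r(1)] B by (auto 0 4 simp: intro_rules_def at_x_def)
    then show "has_proof Gam (with_negation St Gam J) D"
      using less.IH[of v q] Cs(2) D r(2) by simp
  qed
qed

subsection \<open>Saturation\<close>

lemma at_x_inject [simp]: "at_x S = at_x T \<longleftrightarrow> S = T"
  unfolding at_x_def by (rule inj_image_eq_iff) (simp add: inj_def)

lemma ball_at_x [simp]: "(\<forall>a \<in> at_x S. P a) \<longleftrightarrow> (\<forall>p \<in> S. P (Atom p Var))"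
  by (simp add: at_x_def)

lemma Atom_App_notin_at_x [simp]: "Atom q (App g t) \<notin> at_x S"
  by (auto simp: at_x_def)

text \<open>Although premises form a set, the main premise of an elimination rule can be recovered:
  it is the only one whose term is not \<open>Var\<close>.\<close>

lemma insert_App_at_x_inject [simp]:
  "insert (Atom q (App g Var)) (at_x S) = insert (Atom p (App h Var)) (at_x T) \<longleftrightarrow>
    q = p \<and> g = h \<and> S = T"
proof
  assume eq: "insert (Atom q (App g Var)) (at_x S) = insert (Atom p (App h Var)) (at_x T)"
  then have "Atom q (App g Var) \<in> insert (Atom p (App h Var)) (at_x T)" by blast
  then have "q = p \<and> g = h" by simp
  moreover from this eq have "at_x S = at_x T"
    using insert_ident[of "Atom q (App g Var)" "at_x S" "at_x T"] by simp
  ultimately show "q = p \<and> g = h \<and> S = T" by simp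
qed simp

lemma at_x_neq_insert_App [simp]: "at_x S \<noteq> insert (Atom q (App g Var)) A"
  "insert (Atom q (App g Var)) A \<noteq> at_x S"
  by (metis Atom_App_notin_at_x insertI1)+

text \<open>The conclusion tells introduction rules from the others, and a premise at
  \<open>App g Var\<close> tells elimination from neutral rules. So in this and the next three
  lemmas membership in the union reduces to conditions on the carriers.\<close>

lemma intro_App_iff:
  "Rule (at_x S) (Atom q (App g Var)) \<in> small_step_rules St Gam \<longleftrightarrow> S \<subseteq> St \<and> q \<in> St \<and> g \<in> Gam"
  by (auto simp: intro_rules_def elim_rules_def neutral_rules_def)

lemma intro_Eps_iff: "Rule {} (Atom q Eps) \<in> small_step_rules St Gam \<longleftrightarrow> q \<in> St"
  by (auto simp: intro_rules_def elim_rules_def neutral_rules_def)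

lemma elim_iff:
  "Rule (insert (Atom q (App g Var)) (at_x T)) (Atom r Var) \<in> small_step_rules St Gam \<longleftrightarrow>
    q \<in> St \<and> g \<in> Gam \<and> T \<subseteq> St \<and> r \<in> St"
  by (auto simp: intro_rules_def elim_rules_def neutral_rules_def)

lemma neutral_iff: "Rule (at_x T) (Atom r Var) \<in> small_step_rules St Gam \<longleftrightarrow> T \<subseteq> St \<and> r \<in> St"
  by (auto simp: intro_rules_def elim_rules_def neutral_rules_def)

section \<open>Shape and soundness of the saturated rules\<close>

lemma saturation_small_step:
  assumes "I \<subseteq> small_step_rules St Gam" "r \<in> saturation Gam I"
  shows "r \<in> small_step_rules St Gam"
  using assms(2)
proof induction
  case (base r)
  with assms(1) show ?case by blast
next
  case (intro_elim S q g T r)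
  then show ?case unfolding intro_App_iff elim_iff neutral_iff by blast
next
  case (intro_neutral g T S r)
  then show ?case unfolding intro_App_iff neutral_iff by blast
next
  case (empty_neutral T r)
  then show ?case unfolding neutral_iff intro_Eps_iff by blast
qed

text \<open>Each closure step composes its parent rules, so an application of the new rule can be
  replaced by applications of the parents.\<close>

lemma saturation_admissible:
  assumes "r \<in> saturation Gam I" "w \<in> words Gam" "\<forall>a \<in> prems r. provable Gam I (subst_atom w a)"
  shows "provable Gam I (subst_atom w (concl r))"
  using assms
\<comment> \<open>The word must vary: in the case \<open>intro_neutral\<close> the neutral parent is
  applied at \<open>App g w\<close>, and in the case \<open>empty_neutral\<close> at
  \<open>Eps\<close>.\<close>
proof (induction arbitrary: w)
  case (base r)
  then show ?case by (blast intro: provableI)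
next
  case (intro_elim S q g T r)
  from intro_elim.prems have ST: "\<forall>p \<in> S \<union> T. provable Gam I (Atom p w)" by simp
  then have "provable Gam I (Atom q (App g w))"
    using intro_elim.IH(1)[OF intro_elim.prems(1)] by simp
  with ST show ?case
    using intro_elim.IH(2)[OF intro_elim.prems(1)] by simp
next
  case (intro_neutral g T S r)
  have "\<forall>q \<in> T. provable Gam I (Atom q (App g w))"
    using intro_neutral.IH(1)[OF _ intro_neutral.prems(1)] intro_neutral.prems(2) by simp
  then show ?case
    using intro_neutral.IH(2)[of "App g w"] intro_neutral.hyps(1) intro_neutral.prems(1)
    by (simp add: words.App)
next
  case (empty_neutral T r)
  have "\<forall>q \<in> T. provable Gam I (Atom q Eps)"
    using empty_neutral.IH(1)[OF _ empty_neutral.prems(1)] by simp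
  then show ?case
    using empty_neutral.IH(2)[of Eps] by (simp add: words.Eps)
qed

section \<open>Equivalence of the system and its automaton\<close>

context
  fixes St :: "'p set" and Gam :: "'g set" and I :: "('p, 'g) atom rule set"
  assumes I: "I \<subseteq> small_step_rules St Gam"
begin

lemma automaton_intro_rules: "automaton St Gam I \<subseteq> intro_rules St Gam"
  using saturation_small_step[OF I] by (auto simp: automaton_def)

lemma automaton_App_iff:
  "Rule S (Atom q (App g Var)) \<in> automaton St Gam I \<longleftrightarrow> Rule S (Atom q (App g Var)) \<in> saturation Gam I"
  by (auto simp: automaton_def elim_rules_def neutral_rules_def)

lemma automaton_Eps_iff:
  "Rule S (Atom q Eps) \<in> automaton St Gam I \<longleftrightarrow> Rule S (Atom q Eps) \<in> saturation Gam I"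
  by (auto simp: automaton_def elim_rules_def neutral_rules_def)

text \<open>The last rule of a proof in the automaton is an introduction rule, and the outermost
  symbol of the word determines its form.\<close>

lemma automaton_provable_AppE:
  assumes "provable Gam (automaton St Gam I) (Atom q (App g w))"
  obtains S where "Rule (at_x S) (Atom q (App g Var)) \<in> saturation Gam I"
    "\<And>p. p \<in> S \<Longrightarrow> provable Gam (automaton St Gam I) (Atom p w)"
  using assms
proof cases
  case (provableI r v)
  have "r \<in> intro_rules St Gam" using provableI(2) automaton_intro_rules by blast
  with provableI(1) obtain S where "r = Rule (at_x S) (Atom q (App g Var))" "v = w"
    by (auto simp: intro_rules_def)
  then show ?thesis
    using provableI(2) provableI(4)[of "Atom _ Var"]
    by (intro that[of S]) (simp_all add: automaton_App_iff at_x_def)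
qed

lemma automaton_provable_EpsE:
  assumes "provable Gam (automaton St Gam I) (Atom q Eps)"
  shows "Rule {} (Atom q Eps) \<in> saturation Gam I"
  using assms
proof cases
  case (provableI r v)
  have "r \<in> intro_rules St Gam" using provableI(2) automaton_intro_rules by blast
  with provableI(1) have "r = Rule {} (Atom q Eps)"
    by (auto simp: intro_rules_def)
  then show ?thesis
    using provableI(2) by (simp add: automaton_Eps_iff)
qed

lemma automaton_intro_App:
  assumes "Rule (at_x S) (Atom q (App g Var)) \<in> saturation Gam I" "w \<in> words Gam"
    "\<And>p. p \<in> S \<Longrightarrow> provable Gam (automaton St Gam I) (Atom p w)"
  shows "provable Gam (automaton St Gam I) (Atom q (App g w))"
proof -
  have "\<forall>a \<in> at_x S. provable Gam (automaton St Gam I) (subst_atom w a)"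
    using assms(3) by simp
  moreover have "Rule (at_x S) (Atom q (App g Var)) \<in> automaton St Gam I"
    using assms(1) by (simp add: automaton_App_iff)
  ultimately have "provable Gam (automaton St Gam I) (subst_atom w (Atom q (App g Var)))"
    using assms(2) by (metis provableI rule.sel)
  then show ?thesis by simp
qed

text \<open>The proofs of the premises end with introduction rules for the same outermost symbol or
  for \<open>Eps\<close>. Saturation merges these rules with the neutral rule into one introduction
  rule, which applies directly to the subproofs, so no induction on the word is needed.\<close>

lemma automaton_neutral:
  assumes r: "Rule (at_x T) (Atom r Var) \<in> saturation Gam I" and w: "w \<in> words Gam"
    and T: "\<And>q. q \<in> T \<Longrightarrow> provable Gam (automaton St Gam I) (Atom q w)"
  shows "provable Gam (automaton St Gam I) (Atom r w)"
  using w
proof cases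
  case Eps
  then have "Rule {} (Atom r Eps) \<in> automaton St Gam I"
    unfolding automaton_Eps_iff using T automaton_provable_EpsE r
    by (blast intro: saturation.empty_neutral)
  then show ?thesis
    using provableI[of "Rule {} (Atom r Eps)" _ w Gam] Eps w by simp
next
  case (App g v)
  have "\<exists>S. Rule (at_x S) (Atom q (App g Var)) \<in> saturation Gam I \<and>
      (\<forall>p \<in> S. provable Gam (automaton St Gam I) (Atom p v))" if "q \<in> T" for q
    using T[OF that] App automaton_provable_AppE by metis
  \<comment> \<open>One introduction rule is chosen for each premise \<open>q\<close>, giving the
    family \<open>S\<close> that the closure step \<open>intro_neutral\<close> expects.\<close>
  then obtain S where S: "\<And>q. q \<in> T \<Longrightarrow> Rule (at_x (S q)) (Atom q (App g Var)) \<in> saturation Gam I"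
    "\<And>q p. q \<in> T \<Longrightarrow> p \<in> S q \<Longrightarrow> provable Gam (automaton St Gam I) (Atom p v)"
    by metis
  have "Rule (at_x (\<Union>q\<in>T. S q)) (Atom r (App g Var)) \<in> saturation Gam I"
    using App(2) S(1) r by (rule saturation.intro_neutral)
  then show ?thesis
    using automaton_intro_App App S(2) by blast
qed

text \<open>The main premise was derived by an introduction rule; cutting that rule against the
  elimination rule leaves a neutral rule of the saturation, already treated in
  \<open>automaton_neutral\<close>.\<close>

lemma automaton_elim:
  assumes "Rule (insert (Atom q (App g Var)) (at_x T)) (Atom r Var) \<in> saturation Gam I"
    "w \<in> words Gam" "provable Gam (automaton St Gam I) (Atom q (App g w))"
    "\<And>q. q \<in> T \<Longrightarrow> provable Gam (automaton St Gam I) (Atom q w)"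
  shows "provable Gam (automaton St Gam I) (Atom r w)"
proof -
  obtain S where "Rule (at_x S) (Atom q (App g Var)) \<in> saturation Gam I"
    "\<And>p. p \<in> S \<Longrightarrow> provable Gam (automaton St Gam I) (Atom p w)"
    using automaton_provable_AppE[OF assms(3)] by metis
  then show ?thesis
    using automaton_neutral[OF saturation.intro_elim] assms by blast
qed

lemma provable_automaton_iff: "provable Gam (automaton St Gam I) A \<longleftrightarrow> provable Gam I A"
proof
  assume "provable Gam (automaton St Gam I) A"
  then show "provable Gam I A"
    \<comment> \<open>The automaton is a subset of the saturation, whose rules are admissible in
      \<open>I\<close>.\<close>
    by induction (blast intro: saturation_admissible dest: automaton_def[THEN equalityD1, THEN subsetD])
next
  assume "provable Gam I A"
  then show "provable Gam (automaton St Gam I) A"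
  proof induction
    case (provableI r w)
    have r: "r \<in> saturation Gam I" using provableI(1) by (rule saturation.base)
    consider "r \<in> intro_rules St Gam" | "r \<in> elim_rules St Gam" | "r \<in> neutral_rules St"
      using provableI(1) I by blast
    then show ?case
    proof cases
      case 1
      \<comment> \<open>Introduction rules of \<open>I\<close> survive the removal of elimination
        and neutral rules.\<close>
      then have "r \<in> automaton St Gam I"
        using r by (auto simp: automaton_App_iff automaton_Eps_iff intro_rules_def)
      then show ?thesis
        using provableI by (blast intro: provable.intros)
    next
      case 2
      then obtain p g S q where r': "r = Rule (insert (Atom p (App g Var)) (at_x S)) (Atom q Var)"
        by (auto simp: elim_rules_def)
      have "provable Gam (automaton St Gam I) (Atom p (App g w))"
        using provableI.IH[of "Atom p (App g Var)"] r' by simp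
      moreover have "provable Gam (automaton St Gam I) (Atom s w)" if "s \<in> S" for s
        using provableI.IH[of "Atom s Var"] r' that by (simp add: at_x_def)
      ultimately show ?thesis
        using automaton_elim[of p g S q w] r r' provableI(2) by simp
    next
      case 3
      then obtain S q where r': "r = Rule (at_x S) (Atom q Var)"
        by (auto simp: neutral_rules_def)
      have "provable Gam (automaton St Gam I) (Atom s w)" if "s \<in> S" for s
        using provableI.IH[of "Atom s Var"] r' that by (simp add: at_x_def)
      then show ?thesis
        using automaton_neutral[of S q w] r r' provableI(2) by simp
    qed
  qed
qed

end

text \<open>Yields finiteness of the automaton without following the saturation process: the rules
  left in the automaton all lie in this finite set.\<close>

lemma finite_intro_rules:
  assumes "finite St" "finite Gam"
  shows "finite (intro_rules St Gam)"
proof -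
  have "intro_rules St Gam =
      (\<Union>S \<in> Pow St. \<Union>q \<in> St. \<Union>g \<in> Gam. {Rule (at_x S) (Atom q (App g Var))}) \<union>
      (\<Union>q \<in> St. {Rule {} (Atom q Eps)})"
    unfolding intro_rules_def by blast
  then show ?thesis
    using assms by simp
qed

theorem theorem3:
  fixes St :: "'p set" and Gam :: "'g set" and I :: "('p, 'g) atom rule set"
    and A :: "('p, 'g) atom"
  assumes "finite St" and "finite Gam"
    and "small_step_apds St Gam I"
    and "A \<in> configurations St Gam"
  shows "has_proof Gam (with_negation St Gam (automaton St Gam I)) (Neg A) \<longleftrightarrow>
         has_coinductive_proof Gam (with_negation St Gam I) (Neg A)"
proof -
  let ?A = "automaton St Gam I"
  have I: "finite I" "I \<subseteq> small_step_rules St Gam"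
    using assms(3) by (auto simp: small_step_apds_def)
  have sub: "?A \<subseteq> intro_rules St Gam"
    using automaton_intro_rules[OF I(2)] .
  have "finite ?A"
    using finite_subset[OF sub finite_intro_rules[OF assms(1,2)]] .
  \<comment> \<open>Since the automaton has introduction rules only, its co-inductive refutations
    can be replaced by finite ones.\<close>
  have "has_proof Gam (with_negation St Gam ?A) (Neg A) \<longleftrightarrow>
      has_coinductive_proof Gam (with_negation St Gam ?A) (Neg A)"
    using intro_rules_refutation_finite[OF sub] has_coinductive_proof_if_has_proof
    by (metis atom.exhaust)
  also have "\<dots> \<longleftrightarrow> \<not> provable Gam ?A A"
    using sub assms(2) \<open>finite ?A\<close> assms(4) by (intro refutable_iff_unprovable) auto
  also have "\<dots> \<longleftrightarrow> \<not> provable Gam I A"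
    using provable_automaton_iff[OF I(2)] by simp
  also have "\<dots> \<longleftrightarrow> has_coinductive_proof Gam (with_negation St Gam I) (Neg A)"
    using refutable_iff_unprovable[OF I(2) assms(2) I(1) assms(4)] by simp
  finally show ?thesis .
qed

end
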